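(* Let $m \geq 2$ and $r \geq 1$ be integers, let $i_1,\ldots,i_m$ be non-negative integers and $s_1,\ldots,s_m$ positive integers, and assume that $(i_1,\ldots,i_m,r,s_1,\ldots,s_m)$ satisfies Condition A. Then $$D(i_1,\ldots,i_m,r,s_1,\ldots,s_m) \leq s_1\cdots s_m-\Big(s_1-\frac{i_1}{r}\Big)\cdots\Big(s_m-\frac{i_m}{r}\Big),$$ and moreover $$s_1\cdots s_m-\Big(s_1-\frac{i_1}{r}\Big)\cdots\Big(s_m-\frac{i_m}{r}\Big) \leq \min\Big\{\frac{i_1s_2\cdots s_m+s_1i_2s_3\cdots s_m+\cdots+s_1\cdots s_{m-1}i_m}{r},\; s_1\cdots s_m\Big\}.$$
   Context: The function $D$ is defined recursively for integers $r\geq 1$, $i_1,\ldots,i_m\geq 0$ and $s_1,\ldots,s_m\geq 1$ as follows. For one variable, $D(i_1,r,s_1)=\min\{\lfloor i_1/r\rfloor, s_1\}$. For $m\geq 2$, $$D(i_1,\ldots,i_m,r,s_1,\ldots,s_m)=\max_{(u_1,\ldots,u_r)\in A(i_m,r,s_m)}\Big\{(s_m-u_1-\cdots-u_r)D(i_1,\ldots,i_{m-1},r,s_1,\ldots,s_{m-1})+\sum_{k=1}^{r-1}u_k D(i_1,\ldots,i_{m-1},r-k,s_1,\ldots,s_{m-1})+u_r s_1\cdots s_{m-1}\Big\},$$ where $$A(i_m,r,s_m)=\{(u_1,\ldots,u_r)\in\mathbb{N}_0^r \mid u_1+\cdots+u_r\leq s_m \text{ and } u_1+2u_2+\cdots+ru_r\leq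 i_m\}.$$ Condition A: for $m\geq 2$, the tuple $(i_1,\ldots,i_m,r,s_1,\ldots,s_m)$ satisfies Condition A if all of the following hold (empty products are $1$): (A.1) $0\leq i_1\leq s_1,\ldots,0\leq i_{m-1}\leq s_{m-1}$, and $0\leq i_m<rs_m$; (A.2) $s\,(s_1-\frac{i_1}{\ell})\cdots(s_{m-2}-\frac{i_{m-2}}{\ell})\leq \ell\,(s_1-\frac{i_1}{s})\cdots(s_{m-2}-\frac{i_{m-2}}{s})$ for all integers $\ell=2,\ldots,r$ and $s=1,\ldots,\ell-1$; (A.3) $s\,(s_1-\frac{i_1}{r})\cdots(s_{m-1}-\frac{i_{m-1}}{r})\leq r\,(s_1-\frac{i_1}{s})\cdots(s_{m-1}-\frac{i_{m-1}}{s})$ for all integers $s=1,\ldots,r-1$. *)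

theory Defs
  imports Complex_Main "HOL-Library.FuncSet"
begin

text \<open>
  Tuples \<open>(i\<^sub>1, \<dots>, i\<^sub>m)\<close> and \<open>(s\<^sub>1, \<dots>, s\<^sub>m)\<close> are functions on \<open>nat\<close> of which only the values
  at \<open>1, \<dots>, m\<close> matter. Tuples \<open>(u\<^sub>1, \<dots>, u\<^sub>r)\<close> are extensional functions on \<open>{1..r}\<close>, so that
  the sets of such tuples over which maxima are taken are finite.
\<close>

definition A :: "nat \<Rightarrow> nat \<Rightarrow> nat \<Rightarrow> (nat \<Rightarrow> nat) set" where
  "A i r s = {u \<in> {1..r} \<rightarrow>\<^sub>E UNIV. (\<Sum>k=1..r. u k) \<le> s \<and> (\<Sum>k=1..r. k * u k) \<le> i}"

lemma finite_A: "finite (A i r s)"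
proof (rule finite_subset)
  show "A i r s \<subseteq> {1..r} \<rightarrow>\<^sub>E {..s}"
  proof
    fix u assume u: "u \<in> A i r s"
    have "u k \<le> s" if "k \<in> {1..r}" for k
    proof -
      have "u k \<le> (\<Sum>k=1..r. u k)"
        using that by (intro member_le_sum) auto
      then show ?thesis using u by (simp add: A_def)
    qed
    then show "u \<in> {1..r} \<rightarrow>\<^sub>E {..s}"
      using u by (auto simp: A_def PiE_iff)
  qed
  show "finite ({1..r} \<rightarrow>\<^sub>E {..s})"
    by (intro finite_PiE) auto
qed

lemma A_nonempty: "A i r s \<noteq> {}"
proof -
  have "restrict (\<lambda>_. 0) {1..r} \<in> A i r s"
    by (auto simp: A_def)
  then show ?thesis by blast
qed

text \<open>
  The value for \<open>m = 0\<close> is a dummy. The truncated subtractions on \<open>nat\<close> are exact: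
  \<open>u\<^sub>1 + \<dots> + u\<^sub>r \<le> s\<^sub>m\<close> on \<^const>\<open>A\<close>, and \<open>k < r\<close>.
\<close>

fun D :: "nat \<Rightarrow> (nat \<Rightarrow> nat) \<Rightarrow> nat \<Rightarrow> (nat \<Rightarrow> nat) \<Rightarrow> nat" where
  "D 0 i r s = 0"
| "D (Suc 0) i r s = min (i 1 div r) (s 1)"
| "D (Suc (Suc n)) i r s =
    (MAX u \<in> A (i (Suc (Suc n))) r (s (Suc (Suc n))).
       (s (Suc (Suc n)) - (\<Sum>k=1..r. u k)) * D (Suc n) i r s
       + (\<Sum>k=1..r-1. u k * D (Suc n) i (r - k) s)
       + u r * (\<Prod>j=1..Suc n. s j))"

lemma D_rec:
  assumes "m \<ge> 2"
  shows "D m i r s =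
    (MAX u \<in> A (i m) r (s m).
       (s m - (\<Sum>k=1..r. u k)) * D (m - 1) i r s
       + (\<Sum>k=1..r-1. u k * D (m - 1) i (r - k) s)
       + u r * (\<Prod>j=1..m-1. s j))"
proof -
  have "m = Suc (Suc (m - 2))"
    using assms by simp
  then obtain n where n: "m = Suc (Suc n)" ..
  show ?thesis unfolding n D.simps diff_Suc_1 ..
qed

definition condition_A :: "nat \<Rightarrow> (nat \<Rightarrow> nat) \<Rightarrow> nat \<Rightarrow> (nat \<Rightarrow> nat) \<Rightarrow> bool" where
  "condition_A m i r s \<longleftrightarrow>
     (\<forall>j\<in>{1..m-1}. i j \<le> s j) \<and> i m < r * s m \<and>
     (\<forall>l\<in>{2..r}. \<forall>t\<in>{1..l-1}.
        real t * (\<Prod>j=1..m-2. real (s j) - real (i j) / real l)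
        \<le> real l * (\<Prod>j=1..m-2. real (s j) - real (i j) / real t)) \<and>
     (\<forall>t\<in>{1..r-1}.
        real t * (\<Prod>j=1..m-1. real (s j) - real (i j) / real r)
        \<le> real r * (\<Prod>j=1..m-1. real (s j) - real (i j) / real t))"

end

theory Submission
  imports Defs
begin

text \<open>
  Write \<open>P\<^sub>n(l) = \<Prod>\<^sub>j\<^sub>\<le>\<^sub>n (s\<^sub>j - i\<^sub>j / l)\<close> and \<open>S\<^sub>n = \<Prod>\<^sub>j\<^sub>\<le>\<^sub>n s\<^sub>j\<close>. The bound \<open>D \<le> S\<^sub>n - P\<^sub>n(r)\<close> goes by
  induction on the number of variables. If it holds for one variable fewer and for every
  multiplicity up to \<open>r\<close>, then raising \<open>u\<^sub>k\<close> by one in the maximum defining \<open>D\<close> replaces a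
  contribution \<open>S\<^sub>n - P\<^sub>n(r)\<close> by \<open>S\<^sub>n - P\<^sub>n(r - k)\<close> (by \<open>S\<^sub>n\<close> if \<open>k = r\<close>), a gain of
  \<open>P\<^sub>n(r) - P\<^sub>n(r - k)\<close>. If \<open>P\<^sub>n(l) / l\<close> is smallest at \<open>l = r\<close> among \<open>l \<le> r\<close>, this gain is at
  most \<open>k P\<^sub>n(r) / r\<close>. Since \<open>\<Sum> k u\<^sub>k\<close> is at most \<open>i\<close> of the last variable, the total
  gain is at most \<open>P\<^sub>n(r) i / r\<close>, and that is precisely what the next factor of the product
  subtracts (lemma \<open>D_step\<close>).

  For the outermost step this minimality is the last clause of Condition A. The steps below it
  take place at every multiplicity up to \<open>r\<close>, so they need \<open>P\<^sub>n(l) / l\<close> to be nonincreasing on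
  \<open>{1..r}\<close>. The clause of Condition A quantified over all \<open>l \<le> r\<close> gives this for \<open>n = m - 2\<close>, and
  smaller \<open>n\<close> inherit it: the factor that is dropped is positive at the larger multiplicity and
  does not decrease with \<open>l\<close>, so removing it only makes the inequality easier
  (lemma \<open>residual_ratio_antitone_drop\<close>).

  The second inequality of the theorem is the Weierstrass product inequality together with
  \<open>P\<^sub>m(r) \<ge> 0\<close>.
\<close>

definition residual :: "nat \<Rightarrow> (nat \<Rightarrow> nat) \<Rightarrow> nat \<Rightarrow> (nat \<Rightarrow> nat) \<Rightarrow> real" where
  "residual n i l s = (\<Prod>j=1..n. real (s j) - real (i j) / real l)"

definition residual_ratio_antitone :: "nat \<Rightarrow> (nat \<Rightarrow> nat) \<Rightarrow> nat \<Rightarrow> (nat \<Rightarrow> nat) \<Rightarrow> bool" where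
  "residual_ratio_antitone n i r s \<longleftrightarrow>
     (\<forall>l\<in>{2..r}. \<forall>t\<in>{1..l-1}. real t * residual n i l s \<le> real l * residual n i t s)"

lemma residual_Suc:
  "residual (Suc n) i l s = residual n i l s * (real (s (Suc n)) - real (i (Suc n)) / real l)"
  by (simp add: residual_def)

lemma le_mult_imp_divide_le:
  assumes "a \<le> l * b" "l \<ge> 1"
  shows "real a / real l \<le> real b"
proof -
  have "real a \<le> real l * real b"
    using assms(1) by (metis of_nat_le_iff of_nat_mult)
  then show ?thesis
    using assms(2) by (simp add: divide_le_eq mult.commute)
qed

lemma residual_nonneg:
  assumes "\<forall>j\<in>{1..n}. i j \<le> l * s j" "l \<ge> 1"
  shows "residual n i l s \<ge> 0"
  unfolding residual_def
proof (rule prod_nonneg)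
  fix j assume "j \<in> {1..n}"
  then show "0 \<le> real (s j) - real (i j) / real l"
    using assms le_mult_imp_divide_le by simp
qed

lemma le_imp_le_mult:
  fixes a b l :: nat
  assumes "a \<le> b" "l \<ge> 1"
  shows "a \<le> l * b"
  using mult_le_mono[OF assms(2,1)] by simp

text \<open>
  Let \<open>x\<close> and \<open>y\<close> be the last factors at \<open>l\<close> and at \<open>t < l\<close>. Then \<open>y \<le> x\<close>, so \<open>y\<close> may be
  replaced by \<open>x\<close> on the right-hand side and cancelled. Cancelling needs \<open>x > 0\<close>, which is where
  \<open>i \<le> s\<close>, \<open>s > 0\<close> and \<open>l > 1\<close> enter.
\<close>

lemma residual_ratio_antitone_drop:
  assumes "residual_ratio_antitone (Suc n) i r s"
    and "\<forall>j\<in>{1..Suc n}. i j \<le> s j" and "s (Suc n) \<ge> 1"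
  shows "residual_ratio_antitone n i r s"
  unfolding residual_ratio_antitone_def
proof (intro ballI)
  fix l t assume l: "l \<in> {2..r}" and t: "t \<in> {1..l-1}"
  define x where "x = real (s (Suc n)) - real (i (Suc n)) / real l"
  define y where "y = real (s (Suc n)) - real (i (Suc n)) / real t"
  have "real (i (Suc n)) / real l \<le> real (i (Suc n)) / real t"
    using l t by (intro divide_left_mono) auto
  then have yx: "y \<le> x" by (simp add: x_def y_def)
  have "real (i (Suc n)) \<le> real (s (Suc n))" using assms(2) by simp
  also have "\<dots> < real (s (Suc n)) * real l" using l assms(3) by simp
  finally have x: "x > 0" using l by (simp add: x_def divide_less_eq)
  have nonneg: "residual n i t s \<ge> 0"
    using assms(2) t by (intro residual_nonneg) (auto intro: le_imp_le_mult)
  have "real t * residual n i l s * x \<le> real l * residual n i t s * y"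
    using assms(1) l t
    by (simp add: residual_ratio_antitone_def residual_Suc x_def y_def mult.assoc)
  also have "\<dots> \<le> real l * residual n i t s * x"
    using nonneg yx by (intro mult_left_mono) auto
  finally show "real t * residual n i l s \<le> real l * residual n i t s"
    using x by simp
qed

text \<open>
  The inductive step for a single multiplicity \<open>r\<close>. The bound for \<open>n + 1\<close> variables is required at
  all multiplicities up to \<open>r\<close>, because the recursion calls \<open>D\<close> at each \<open>r - k\<close>.
\<close>

lemma D_step:
  assumes r: "r \<ge> 1"
    and bound: "\<And>l. l \<in> {1..r} \<Longrightarrow>
      real (D (Suc n) i l s) \<le> (\<Prod>j=1..Suc n. real (s j)) - residual (Suc n) i l s"
    and ratio: "\<And>t. t \<in> {1..r-1} \<Longrightarrow>
      real t * residual (Suc n) i r s \<le> real r * residual (Suc n) i t s"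
    and nonneg: "residual (Suc n) i r s \<ge> 0"
  shows "real (D (Suc (Suc n)) i r s)
    \<le> (\<Prod>j=1..Suc (Suc n). real (s j)) - residual (Suc (Suc n)) i r s"
proof -
  define S where "S = (\<Prod>j=1..Suc n. real (s j))"
  define P where "P = (\<lambda>l. residual (Suc n) i l s)"
  define N where "N = Suc (Suc n)"
  define F where "F = (\<lambda>u. (s N - (\<Sum>k=1..r. u k)) * D (Suc n) i r s
       + (\<Sum>k=1..r-1. u k * D (Suc n) i (r - k) s) + u r * (\<Prod>j=1..Suc n. s j))"
  have "real (F u) \<le> S * real (s N) - P r * (real (s N) - real (i N) / real r)"
    if u: "u \<in> A (i N) r (s N)" for u
  proof -
    define U where "U = (\<Sum>k=1..r-1. real (u k))"
    have range: "{1..r} = insert r {1..r-1}" "r \<notin> {1..r-1}" using r by auto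
    have sumU: "(\<Sum>k=1..r. real (u k)) = U + real (u r)"
      unfolding range(1) U_def using range(2) by simp
    have le: "(\<Sum>k=1..r. u k) \<le> s N" using u by (simp add: A_def)
    have "(\<Sum>k=1..r. k * u k) \<le> i N" using u by (simp add: A_def)
    then have "real (\<Sum>k=1..r. k * u k) \<le> real (i N)" by (simp only: of_nat_le_iff)
    moreover have "real (\<Sum>k=1..r. k * u k)
        = (\<Sum>k=1..r-1. real k * real (u k)) + real r * real (u r)"
      unfolding range(1) using range(2) by simp
    ultimately have weight: "(\<Sum>k=1..r-1. real k * real (u k)) + real r * real (u r) \<le> real (i N)"
      by simp
    have "real (F u) = (real (s N) - U - real (u r)) * real (D (Suc n) i r s)
        + (\<Sum>k=1..r-1. real (u k) * real (D (Suc n) i (r - k) s)) + real (u r) * S"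
      using le sumU by (simp add: F_def S_def of_nat_diff)
    also have "\<dots> \<le> (real (s N) - U - real (u r)) * (S - P r)
        + (\<Sum>k=1..r-1. real (u k) * (S - P r + real k * P r / real r)) + real (u r) * S"
    proof -
      have "real (\<Sum>k=1..r. u k) \<le> real (s N)" using le by (simp only: of_nat_le_iff)
      then have "0 \<le> real (s N) - U - real (u r)" using sumU by simp
      moreover have "real (D (Suc n) i r s) \<le> S - P r"
        using bound[of r] r by (simp add: S_def P_def)
      moreover have "real (D (Suc n) i (r - k) s) \<le> S - P r + real k * P r / real r"
        if k: "k \<in> {1..r-1}" for k
      proof -
        have "real (D (Suc n) i (r - k) s) \<le> S - P (r - k)"
          using bound[of "r - k"] k by (auto simp: S_def P_def)
        moreover have "(real r - real k) * P r \<le> real r * P (r - k)"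
        proof -
          have "r - k \<in> {1..r-1}" "k \<le> r" using k by auto
          then show ?thesis using ratio[of "r - k"] by (simp add: P_def of_nat_diff)
        qed
        then have "P r - real k * P r / real r \<le> P (r - k)"
          using r by (simp add: field_simps)
        ultimately show ?thesis by simp
      qed
      ultimately show ?thesis
        by (intro add_mono mult_left_mono sum_mono) auto
    qed
    also have "\<dots> = real (s N) * (S - P r)
        + ((\<Sum>k=1..r-1. real k * real (u k)) + real r * real (u r)) * (P r / real r)"
    proof -
      have "(\<Sum>k=1..r-1. real (u k) * (S - P r + real k * P r / real r))
          = U * (S - P r) + (\<Sum>k=1..r-1. real k * real (u k)) * (P r / real r)"
        unfolding U_def sum_distrib_right sum.distrib[symmetric]
        by (intro sum.cong) (auto simp: algebra_simps)
      then show ?thesis using r by (simp add: algebra_simps)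
    qed
    also have "\<dots> \<le> real (s N) * (S - P r) + real (i N) * (P r / real r)"
      using weight nonneg by (intro add_left_mono mult_right_mono) (auto simp: P_def)
    finally show ?thesis by (simp add: algebra_simps)
  qed
  moreover have "D N i r s = Max (F ` A (i N) r (s N))"
    by (simp add: N_def F_def)
  then have "D N i r s \<in> F ` A (i N) r (s N)"
    using Max_in[of "F ` A (i N) r (s N)"] finite_A A_nonempty by simp
  ultimately have "real (D N i r s) \<le> S * real (s N) - P r * (real (s N) - real (i N) / real r)"
    by auto
  then show ?thesis by (simp add: N_def S_def P_def residual_Suc)
qed

lemma D_bound:
  assumes "residual_ratio_antitone n i r s"
    and "\<forall>j\<in>{1..n}. i j \<le> s j \<and> s j \<ge> 1" and "l \<in> {1..r}"
  shows "real (D (Suc n) i l s) \<le> (\<Prod>j=1..Suc n. real (s j)) - residual (Suc n) i l s"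
  using assms
proof (induction n arbitrary: l)
  case 0
  have "real (min (i 1 div l) (s 1)) \<le> real (i 1 div l)" by simp
  also have "\<dots> \<le> real (i 1) / real l" by (rule of_nat_div_le_of_nat)
  finally show ?case by (simp add: residual_def)
next
  case (Suc n)
  have "residual_ratio_antitone n i r s"
    using Suc.prems residual_ratio_antitone_drop[of n i r s] by auto
  then have "real (D (Suc n) i l' s) \<le> (\<Prod>j=1..Suc n. real (s j)) - residual (Suc n) i l' s"
    if "l' \<in> {1..l}" for l'
    using Suc.IH[of l'] Suc.prems that by auto
  moreover have "real t * residual (Suc n) i l s \<le> real l * residual (Suc n) i t s"
    if "t \<in> {1..l-1}" for t
    using Suc.prems(1,3) that unfolding residual_ratio_antitone_def by auto
  moreover have "residual (Suc n) i l s \<ge> 0"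
    using Suc.prems by (intro residual_nonneg) (auto intro: le_imp_le_mult)
  ultimately show ?case
    using Suc.prems(3) by (intro D_step) auto
qed

text \<open>
  The Weierstrass product inequality. Peeling off the factor of \<open>x\<close>, the term weighted by \<open>a x\<close> is
  the induction hypothesis, and in the term weighted by \<open>- b x\<close> the product only shrinks when \<open>a\<close>
  is replaced by \<open>a - b\<close>.
\<close>

lemma prod_diff_ge_prod_minus_sum:
  fixes a b :: "'i \<Rightarrow> 'a::linordered_idom"
  assumes "finite I" "\<And>j. j \<in> I \<Longrightarrow> 0 \<le> b j \<and> b j \<le> a j"
  shows "(\<Prod>j\<in>I. a j) - (\<Sum>j\<in>I. b j * (\<Prod>k\<in>I - {j}. a k)) \<le> (\<Prod>j\<in>I. a j - b j)"
  using assms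
proof (induction I rule: finite_induct)
  case empty
  then show ?case by simp
next
  case (insert x I)
  let ?E = "\<lambda>J. \<Sum>j\<in>J. b j * (\<Prod>k\<in>J - {j}. a k)"
  have "(\<Prod>k\<in>insert x I - {j}. a k) = a x * (\<Prod>k\<in>I - {j}. a k)" if "j \<in> I" for j
  proof -
    have "insert x I - {j} = insert x (I - {j})" using insert.hyps that by auto
    then show ?thesis using insert.hyps by simp
  qed
  then have "?E (insert x I) = b x * (\<Prod>k\<in>I. a k) + a x * ?E I"
    using insert.hyps by (simp add: sum_distrib_left mult.left_commute)
  then have "(\<Prod>j\<in>insert x I. a j) - ?E (insert x I)
      = a x * ((\<Prod>j\<in>I. a j) - ?E I) - b x * (\<Prod>j\<in>I. a j)"
    using insert.hyps by (simp add: algebra_simps)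
  also have "\<dots> \<le> a x * (\<Prod>j\<in>I. a j - b j) - b x * (\<Prod>j\<in>I. a j - b j)"
  proof (rule diff_mono)
    have "0 \<le> a x" using insert.prems[of x] by force
    then show "a x * ((\<Prod>j\<in>I. a j) - ?E I) \<le> a x * (\<Prod>j\<in>I. a j - b j)"
      using insert.IH insert.prems by (intro mult_left_mono) auto
    have "(\<Prod>j\<in>I. a j - b j) \<le> (\<Prod>j\<in>I. a j)"
      using insert.prems by (intro prod_mono) auto
    then show "b x * (\<Prod>j\<in>I. a j - b j) \<le> b x * (\<Prod>j\<in>I. a j)"
      using insert.prems[of x] by (intro mult_left_mono) auto
  qed
  also have "\<dots> = (\<Prod>j\<in>insert x I. a j - b j)"
    using insert.hyps by (simp add: algebra_simps)
  finally show ?case .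
qed

theorem theorem14:
  fixes m r :: nat and i s :: "nat \<Rightarrow> nat"
  assumes "m \<ge> 2" and "r \<ge> 1"
    and "\<forall>j\<in>{1..m}. s j \<ge> 1"
    and "condition_A m i r s"
  shows "real (D m i r s)
           \<le> (\<Prod>j=1..m. real (s j)) - (\<Prod>j=1..m. real (s j) - real (i j) / real r)
       \<and> (\<Prod>j=1..m. real (s j)) - (\<Prod>j=1..m. real (s j) - real (i j) / real r)
           \<le> min ((\<Sum>j=1..m. real (i j) * (\<Prod>k\<in>{1..m} - {j}. real (s k))) / real r)
                 (\<Prod>j=1..m. real (s j))"
proof -
  obtain n where m: "m = Suc (Suc n)"
    using assms(1) by (metis add_2_eq_Suc le_Suc_ex)
  have is_le: "i j \<le> s j" if "j \<in> {1..Suc n}" for j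
    using assms(4) that by (simp add: condition_A_def m)
  have last: "i m < r * s m" using assms(4) by (simp add: condition_A_def)
  have ratio: "residual_ratio_antitone n i r s"
    using assms(4)
    by (simp add: condition_A_def residual_ratio_antitone_def residual_def m)
  have top: "real t * residual (Suc n) i r s \<le> real r * residual (Suc n) i t s"
    if "t \<in> {1..r-1}" for t
    using assms(4) that unfolding condition_A_def residual_def m diff_Suc_1 by blast
  have irs: "i j \<le> r * s j" if "j \<in> {1..m}" for j
  proof (cases "j = m")
    case True
    then show ?thesis using last by simp
  next
    case False
    then show ?thesis using that assms(2) by (intro le_imp_le_mult is_le) (auto simp: m)
  qed
  have "real (D m i r s) \<le> (\<Prod>j=1..m. real (s j)) - residual m i r s"
    unfolding m
  proof (rule D_step[OF assms(2) _ top])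
    fix l assume "l \<in> {1..r}"
    then show "real (D (Suc n) i l s) \<le> (\<Prod>j=1..Suc n. real (s j)) - residual (Suc n) i l s"
      using assms(3) is_le by (intro D_bound[OF ratio]) (auto simp: m)
  next
    show "0 \<le> residual (Suc n) i r s"
      using irs assms(2) by (intro residual_nonneg) (auto simp: m)
  qed
  moreover have "(\<Prod>j=1..m. real (s j)) - residual m i r s
      \<le> (\<Sum>j=1..m. real (i j) * (\<Prod>k\<in>{1..m} - {j}. real (s k))) / real r"
    using prod_diff_ge_prod_minus_sum[of "{1..m}" "\<lambda>j. real (i j) / real r" "\<lambda>j. real (s j)"]
      irs assms(2) le_mult_imp_divide_le
    by (simp add: residual_def sum_divide_distrib)
  moreover have "0 \<le> residual m i r s"
    using irs assms(2) by (intro residual_nonneg) auto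
  ultimately show ?thesis by (simp add: residual_def)
qed

end
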